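(* Let $p$ be a prime, $p>3$, and let $t\in D_p$. If $t\not\equiv 0\pmod p$, then modulo $p$: \begin{align*} \sum_{k=1}^{\lfloor p/3\rfloor}C_k^{(2)}\bigl(t^{2}(t+1)\bigr)^k&\equiv \frac{1+t}{2t}-\frac{1-3t}{2t}\left(\frac{(1+t)(1-3t)}{p}\right),\\ \sum_{k=1}^{p-1}C_k^{(2)}\bigl(t^2(t+1)\bigr)^k&\equiv \frac{(1+t)(1-3t)}{2t}\left(1-\left(\frac{(1+t)(1-3t)}{p}\right)\right). \end{align*} If $3t+2\not\equiv 0\pmod p$, then modulo $p$: \begin{align*} \sum_{k=1}^{\lfloor p/3\rfloor}\binom{3k}{k}\bigl(t^2(t+1)\bigr)^k&\equiv \frac{3(t+1)}{2(3t+2)}\left(\left(\frac{(1+t)(1-3t)}{p}\right)-1\right),\\ \sum_{k=1}^{p-1}\binom{3k}{k}\bigl(t^2(t+1)\bigr)^k&\equiv \frac{3(t+1)^2}{2(3t+2)}\left(\left(\frac{(1+t)(1-3t)}{p}\right)-1\right). \end{align*}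
   Context: $C_n^{(2)}=\frac{1}{2n+1}\binom{3n}{n}$. $D_p$ is the set of rationals whose denominator is not divisible by $p$; congruences are in the usual sense. For $c=a/b\in D_p$ in lowest terms, $\left(\frac{c}{p}\right)=\left(\frac{ab}{p}\right)$ (Legendre symbol), which is $0$ if $p\mid a$. *)

theory Defs
  imports Complex_Main "HOL-Number_Theory.Number_Theory"
begin

definition D :: "nat \<Rightarrow> rat set"
  where "D p = {r. \<not> int p dvd snd (quotient_of r)}"

definition rat_cong :: "nat \<Rightarrow> rat \<Rightarrow> rat \<Rightarrow> bool"
  where "rat_cong p x y \<longleftrightarrow> (\<exists>z \<in> D p. x - y = of_nat p * z)"

(* quotient_of returns the numerator and denominator in lowest terms. *)
definition rat_Legendre :: "rat \<Rightarrow> nat \<Rightarrow> int"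
  where "rat_Legendre c p = Legendre (fst (quotient_of c) * snd (quotient_of c)) (int p)"

definition catalan2 :: "nat \<Rightarrow> rat"
  where "catalan2 n = 1 / of_nat (2 * n + 1) * of_nat ((3 * n) choose n)"

end

theory Submission
  imports Defs
begin

text \<open>
  Put \<open>z = t\<^sup>2 (t + 1)\<close> and \<open>d\<^sub>n = \<Sum>\<^sub>k binom (n - 2k) k (- z)\<^sup>k\<close>. For \<open>k < p\<close> a binomial coefficient
  \<open>binom x k\<close> modulo \<open>p\<close> depends only on \<open>x\<close> modulo \<open>p\<close>, hence for every multiple \<open>n\<close> of \<open>p\<close>
  \<open>binom (3k) k = (-1)\<^sup>k binom (- 2k - 1) k \<equiv> (-1)\<^sup>k binom (n - 1 - 2k) k\<close>.
  Taking \<open>n = p\<close> and \<open>n = 2p\<close>, the truncated and the full sum of the \<open>binom (3k) k z\<^sup>k\<close> become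
  \<open>d\<^sub>n\<^sub>-\<^sub>1\<close>. Since \<open>catalan2 k = binom (3k) k - 2 binom (3k) (k - 1)\<close>, its sums become
  \<open>3 d\<^sub>n\<^sub>-\<^sub>1 - 2 d\<^sub>n\<^sub>-\<^sub>2\<close> in the same way. The characteristic polynomial of \<open>d\<close> is
  \<open>X\<^sup>3 - X\<^sup>2 + z = (X + t) (X\<^sup>2 - (t + 1) X + t (t + 1))\<close>, so \<open>d\<^sub>n\<^sub>-\<^sub>1\<close> is a combination of
  \<open>(- t)\<^sup>n\<close> and of the Lucas sequences \<open>U\<^sub>n\<close> and \<open>V\<^sub>n\<close> of the quadratic factor. Its discriminant is
  \<open>(1 + t) (1 - 3t)\<close>, and \<open>U\<^sub>p\<close>, \<open>V\<^sub>p\<close> are evaluated modulo \<open>p\<close> by the binomial theorem,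
  Fermat's little theorem and Euler's criterion.
\<close>

section \<open>Lucas sequences\<close>

fun lucas_U :: "'a::comm_ring_1 \<Rightarrow> 'a \<Rightarrow> nat \<Rightarrow> 'a" where
  "lucas_U a b 0 = 0"
| "lucas_U a b (Suc 0) = 1"
| "lucas_U a b (Suc (Suc n)) = a * lucas_U a b (Suc n) - b * lucas_U a b n"

fun lucas_V :: "'a::comm_ring_1 \<Rightarrow> 'a \<Rightarrow> nat \<Rightarrow> 'a" where
  "lucas_V a b 0 = 2"
| "lucas_V a b (Suc 0) = a"
| "lucas_V a b (Suc (Suc n)) = a * lucas_V a b (Suc n) - b * lucas_V a b n"

lemma lucas_V_eq_lucas_U: "lucas_V a b n = 2 * lucas_U a b (Suc n) - a * lucas_U a b n"
proof (induction n rule: induct_nat_012)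
  case (ge2 n)
  show ?case
    unfolding lucas_V.simps(3) ge2 by (simp add: algebra_simps)
qed simp_all

lemma two_lucas_U_Suc: "2 * lucas_U a b (Suc n) = a * lucas_U a b n + lucas_V a b n"
  by (simp add: lucas_V_eq_lucas_U)

lemma two_lucas_V_Suc:
  "2 * lucas_V a b (Suc n) = a * lucas_V a b n + (a\<^sup>2 - 4 * b) * lucas_U a b n"
  by (simp add: lucas_V_eq_lucas_U algebra_simps power2_eq_square)

lemma lucas_U_add:
  "lucas_U a b (Suc (m + n))
     = lucas_U a b (Suc m) * lucas_U a b (Suc n) - b * lucas_U a b m * lucas_U a b n"
proof (induction m rule: induct_nat_012)
  case (ge2 m)
  have "lucas_U a b (Suc (Suc (Suc m) + n))
      = a * lucas_U a b (Suc (Suc m + n)) - b * lucas_U a b (Suc (m + n))"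
    by simp
  then show ?case
    unfolding ge2 by (simp add: algebra_simps)
qed simp_all

lemma lucas_U_cassini:
  "(lucas_U a b (Suc n))\<^sup>2 - a * lucas_U a b (Suc n) * lucas_U a b n + b * (lucas_U a b n)\<^sup>2
     = b ^ n"
proof (induction n)
  case (Suc n)
  have "(lucas_U a b (Suc (Suc n)))\<^sup>2 - a * lucas_U a b (Suc (Suc n)) * lucas_U a b (Suc n)
        + b * (lucas_U a b (Suc n))\<^sup>2
      = b * ((lucas_U a b (Suc n))\<^sup>2 - a * lucas_U a b (Suc n) * lucas_U a b n
          + b * (lucas_U a b n)\<^sup>2)"
    by (simp add: algebra_simps power2_eq_square)
  then show ?case
    by (simp only: Suc power_Suc)
qed simp

lemma lucas_U_double: "lucas_U a b (2 * n) = lucas_U a b n * lucas_V a b n"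
proof (cases n)
  case (Suc m)
  have "lucas_U a b (2 * n) = lucas_U a b (Suc (n + m))"
    using Suc by (simp add: mult_2)
  then show ?thesis
    unfolding lucas_U_add by (simp add: Suc lucas_V_eq_lucas_U algebra_simps)
qed simp

lemma lucas_V_double: "lucas_V a b (2 * n) = (lucas_V a b n)\<^sup>2 - 2 * b ^ n"
proof -
  define x y where "x = lucas_U a b (Suc n)" and "y = lucas_U a b n"
  have V: "lucas_V a b n = 2 * x - a * y"
    by (simp only: x_def y_def lucas_V_eq_lucas_U)
  have "lucas_U a b (Suc (2 * n)) = x * x - b * y * y"
    unfolding mult_2 x_def y_def by (rule lucas_U_add)
  moreover have "lucas_U a b (2 * n) = y * (2 * x - a * y)"
    by (simp only: lucas_U_double V y_def)
  ultimately have "lucas_V a b (2 * n) = 2 * (x * x - b * y * y) - a * (y * (2 * x - a * y))"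
    by (simp only: lucas_V_eq_lucas_U [of a b "2 * n"])
  also have "\<dots> = (2 * x - a * y)\<^sup>2 - 2 * (x\<^sup>2 - a * x * y + b * y\<^sup>2)"
    by (simp add: algebra_simps power2_eq_square)
  also have "\<dots> = (lucas_V a b n)\<^sup>2 - 2 * b ^ n"
    by (simp only: V x_def y_def lucas_U_cassini)
  finally show ?thesis .
qed

definition binomial_transform :: "'a::comm_ring_1 \<Rightarrow> (nat \<Rightarrow> 'a) \<Rightarrow> nat \<Rightarrow> 'a"
  where "binomial_transform a w n = (\<Sum>i\<le>n. of_nat (n choose i) * a ^ (n - i) * w i)"

lemma binomial_transform_0 [simp]: "binomial_transform a w 0 = w 0"
  by (simp add: binomial_transform_def)

lemma binomial_transform_Suc:
  "binomial_transform a w (Suc n)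
     = a * binomial_transform a w n + binomial_transform a (\<lambda>i. w (Suc i)) n"
proof -
  have "a * binomial_transform a w n = (\<Sum>i\<le>n. of_nat (n choose i) * a ^ (Suc n - i) * w i)"
    unfolding binomial_transform_def sum_distrib_left
    by (rule sum.cong) (auto simp: Suc_diff_le algebra_simps)
  also have "\<dots> = (\<Sum>i\<le>Suc n. of_nat (n choose i) * a ^ (Suc n - i) * w i)"
    by (simp add: binomial_eq_0)
  also have "\<dots> = a ^ Suc n * w 0 + (\<Sum>i\<le>n. of_nat (n choose Suc i) * a ^ (n - i) * w (Suc i))"
    by (subst sum.atMost_Suc_shift) simp
  finally have shift: "a * binomial_transform a w n
    = a ^ Suc n * w 0 + (\<Sum>i\<le>n. of_nat (n choose Suc i) * a ^ (n - i) * w (Suc i))" .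
  have "binomial_transform a w (Suc n) = a ^ Suc n * w 0
     + (\<Sum>i\<le>n. of_nat (Suc n choose Suc i) * a ^ (n - i) * w (Suc i))"
    unfolding binomial_transform_def by (subst sum.atMost_Suc_shift) simp
  also have "\<dots> = a * binomial_transform a w n + binomial_transform a (\<lambda>i. w (Suc i)) n"
    unfolding shift by (simp add: binomial_transform_def sum.distrib algebra_simps)
  finally show ?thesis .
qed

lemma binomial_transform_scale:
  "binomial_transform a (\<lambda>i. c * w i) n = c * binomial_transform a w n"
  by (simp add: binomial_transform_def sum_distrib_left algebra_simps)

definition even_powers :: "'a::comm_ring_1 \<Rightarrow> nat \<Rightarrow> 'a"
  where "even_powers d i = (if even i then d ^ (i div 2) else 0)"

definition odd_powers :: "'a::comm_ring_1 \<Rightarrow> nat \<Rightarrow> 'a"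
  where "odd_powers d i = (if odd i then d ^ (i div 2) else 0)"

lemma even_powers_Suc: "even_powers d (Suc i) = d * odd_powers d i"
  by (auto simp: even_powers_def odd_powers_def elim!: oddE)

lemma odd_powers_Suc: "odd_powers d (Suc i) = even_powers d i"
  by (auto simp: even_powers_def odd_powers_def elim!: evenE)

text \<open>Expands \<open>(a \<plusminus> s)\<^sup>n\<close>, where \<open>s\<^sup>2 = a\<^sup>2 - 4b\<close>, by the binomial theorem.\<close>

lemma lucas_eq_binomial_transform:
  "2 ^ n * lucas_V a b n = 2 * binomial_transform a (even_powers (a\<^sup>2 - 4 * b)) n"
  "2 ^ n * lucas_U a b n = 2 * binomial_transform a (odd_powers (a\<^sup>2 - 4 * b)) n"
proof (induction n)
  case 0
  show "2 ^ 0 * lucas_V a b 0 = 2 * binomial_transform a (even_powers (a\<^sup>2 - 4 * b)) 0"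
    "2 ^ 0 * lucas_U a b 0 = 2 * binomial_transform a (odd_powers (a\<^sup>2 - 4 * b)) 0"
    by (simp_all add: even_powers_def odd_powers_def)
next
  case (Suc n)
  let ?d = "a\<^sup>2 - 4 * b"
  have "2 ^ Suc n * lucas_V a b (Suc n) = 2 ^ n * (2 * lucas_V a b (Suc n))"
    by simp
  also have "\<dots> = a * (2 ^ n * lucas_V a b n) + ?d * (2 ^ n * lucas_U a b n)"
    unfolding two_lucas_V_Suc by (simp only: distrib_left mult.left_commute)
  finally show "2 ^ Suc n * lucas_V a b (Suc n) = 2 * binomial_transform a (even_powers ?d) (Suc n)"
    unfolding Suc binomial_transform_Suc even_powers_Suc binomial_transform_scale
    by (simp only: distrib_left mult.left_commute)
  have "2 ^ Suc n * lucas_U a b (Suc n) = 2 ^ n * (2 * lucas_U a b (Suc n))"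
    by simp
  also have "\<dots> = a * (2 ^ n * lucas_U a b n) + 2 ^ n * lucas_V a b n"
    unfolding two_lucas_U_Suc by (simp only: distrib_left mult.left_commute)
  finally show "2 ^ Suc n * lucas_U a b (Suc n) = 2 * binomial_transform a (odd_powers ?d) (Suc n)"
    unfolding Suc binomial_transform_Suc odd_powers_Suc
    by (simp only: distrib_left mult.left_commute)
qed

section \<open>Diagonal sums of Pascal's triangle\<close>

definition diagonal_sum :: "nat \<Rightarrow> 'a::comm_ring_1 \<Rightarrow> nat \<Rightarrow> 'a"
  where "diagonal_sum m y n = (\<Sum>k\<le>n. of_nat ((n - m * k) choose k) * y ^ k)"

lemma diagonal_sum_eq:
  assumes "n < (m + 1) * (K + 1)"
  shows "diagonal_sum m y n = (\<Sum>k\<le>K. of_nat ((n - m * k) choose k) * y ^ k)"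
proof -
  have vanish: "(n - m * k) choose k = 0" if "n < (m + 1) * k" for k
  proof -
    have "n < m * k + k" "0 < k"
      using that by (auto intro: gr0I)
    then show ?thesis
      by (intro binomial_eq_0) arith
  qed
  have "n < (m + 1) * k" if "n < k \<or> K < k" for k
  proof -
    have "k \<le> (m + 1) * k" and "(m + 1) * (K + 1) \<le> (m + 1) * k \<or> k \<le> K"
      using mult_le_mono2 [of "K + 1" k "m + 1"] by auto
    then show ?thesis
      using that assms by linarith
  qed
  then show ?thesis
    unfolding diagonal_sum_def by (intro sum.mono_neutral_cong) (auto simp: vanish)
qed

lemma diagonal_sum_eq_1: "n \<le> m \<Longrightarrow> diagonal_sum m y n = 1"
  by (subst diagonal_sum_eq [of _ _ 0]) auto

lemma diagonal_sum_rec: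
  "diagonal_sum m y (n + m + 1) = diagonal_sum m y (n + m) + y * diagonal_sum m y n"
proof -
  have pascal: "(n + m + 1 - m * Suc k) choose Suc k
      = ((n + m - m * Suc k) choose Suc k) + ((n - m * k) choose k)" for k
  proof (cases "m * k \<le> n")
    case True
    then have "n + m + 1 - m * Suc k = Suc (n - m * k)" "n + m - m * Suc k = n - m * k"
      by auto
    then show ?thesis by simp
  next
    case False
    then show ?thesis by (cases k) auto
  qed
  have bound: "n + m + 1 < (m + 1) * (Suc n + 1)" "n + m < (m + 1) * (Suc n + 1)"
    by simp_all
  have "diagonal_sum m y (n + m + 1)
      = 1 + (\<Sum>k\<le>n. of_nat ((n + m + 1 - m * Suc k) choose Suc k) * y ^ Suc k)"
    by (simp only: diagonal_sum_eq [OF bound(1)] sum.atMost_Suc_shift) simp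
  also have "\<dots> = 1 + (\<Sum>k\<le>n. of_nat ((n + m - m * Suc k) choose Suc k) * y ^ Suc k)
      + (\<Sum>k\<le>n. of_nat ((n - m * k) choose k) * y ^ Suc k)"
    by (simp only: pascal of_nat_add distrib_right sum.distrib) (simp only: add.assoc)
  also have "1 + (\<Sum>k\<le>n. of_nat ((n + m - m * Suc k) choose Suc k) * y ^ Suc k)
      = diagonal_sum m y (n + m)"
    by (simp only: diagonal_sum_eq [OF bound(2)] sum.atMost_Suc_shift) simp
  also have "(\<Sum>k\<le>n. of_nat ((n - m * k) choose k) * y ^ Suc k) = y * diagonal_sum m y n"
    by (simp add: diagonal_sum_def sum_distrib_left mult_ac)
  finally show ?thesis .
qed

lemma diagonal_sum_2_Suc_plus:
  fixes t :: "'a::comm_ring_1"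
  defines "d \<equiv> diagonal_sum 2 (- (t\<^sup>2 * (t + 1)))"
  shows "d (Suc n) + t * d n = lucas_U (t + 1) (t * (t + 1)) (Suc (Suc n))"
proof (induction n rule: induct_nat_012)
  case 0
  show ?case by (simp add: d_def diagonal_sum_eq_1)
next
  case 1
  show ?case by (simp add: d_def diagonal_sum_eq_1 algebra_simps)
next
  case (ge2 n)
  have "d (Suc (Suc (Suc n))) + t * d (Suc (Suc n))
    = (t + 1) * (d (Suc (Suc n)) + t * d (Suc n)) - t * (t + 1) * (d (Suc n) + t * d n)"
    using diagonal_sum_rec [of 2 "- (t\<^sup>2 * (t + 1))" n]
    by (simp add: d_def algebra_simps power2_eq_square)
  then show ?case
    by (simp only: ge2 lucas_U.simps(3))
qed

lemma diagonal_sum_2_closed_form: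
  fixes t :: "'a::comm_ring_1"
  defines "d \<equiv> diagonal_sum 2 (- (t\<^sup>2 * (t + 1)))"
    and "U \<equiv> lucas_U (t + 1) (t * (t + 1))" and "V \<equiv> lucas_V (t + 1) (t * (t + 1))"
  shows "2 * (3 * t + 2) * d n = 3 * (t + 1) * U (Suc n) + V (Suc n) - 2 * (- t) ^ Suc n"
proof (induction n)
  case 0
  show ?case by (simp add: d_def U_def V_def diagonal_sum_eq_1 algebra_simps)
next
  case (Suc n)
  have "d (Suc n) = U (Suc (Suc n)) - t * d n"
    using diagonal_sum_2_Suc_plus [of t n] by (simp add: d_def U_def algebra_simps)
  then have "2 * (3 * t + 2) * d (Suc n) = 2 * (3 * t + 2) * (U (Suc (Suc n)) - t * d n)"
    by (rule arg_cong)
  also have "\<dots> = 2 * (3 * t + 2) * U (Suc (Suc n)) - t * (2 * (3 * t + 2) * d n)"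
    by (simp add: algebra_simps)
  finally show ?case
    unfolding Suc by (simp add: U_def V_def lucas_V_eq_lucas_U algebra_simps)
qed

lemma diagonal_sum_2_catalan_closed_form:
  fixes t :: "'a::comm_ring_1"
  defines "d \<equiv> diagonal_sum 2 (- (t\<^sup>2 * (t + 1)))"
    and "U \<equiv> lucas_U (t + 1) (t * (t + 1))" and "V \<equiv> lucas_V (t + 1) (t * (t + 1))"
  shows "2 * t * (3 * d (Suc n) - 2 * d n)
    = (3 * t - 1) * U (Suc (Suc n)) + V (Suc (Suc n)) - 2 * (- t) ^ Suc (Suc n)"
proof -
  have "2 * t * (3 * d (Suc n) - 2 * d n) = 2 * (3 * t + 2) * d (Suc n) - 4 * (d (Suc n) + t * d n)"
    by (simp add: algebra_simps)
  also have "\<dots> = 3 * (t + 1) * U (Suc (Suc n)) + V (Suc (Suc n)) - 2 * (- t) ^ Suc (Suc n)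
      - 4 * U (Suc (Suc n))"
    unfolding d_def U_def V_def diagonal_sum_2_Suc_plus diagonal_sum_2_closed_form ..
  finally show ?thesis by (simp add: algebra_simps)
qed

section \<open>Fuss--Catalan numbers\<close>

definition fuss_catalan :: "nat \<Rightarrow> nat \<Rightarrow> rat"
  where "fuss_catalan m k = of_nat (((m + 1) * k) choose k) / of_nat (m * k + 1)"

lemma catalan2_eq_fuss_catalan: "catalan2 = fuss_catalan 2"
  by (simp add: fun_eq_iff catalan2_def fuss_catalan_def)

lemma fuss_catalan_Suc:
  "fuss_catalan m (Suc k)
     = of_nat (((m + 1) * Suc k) choose Suc k) - of_nat m * of_nat (((m + 1) * Suc k) choose k)"
proof -
  define A B :: rat where "A = of_nat (((m + 1) * Suc k) choose Suc k)"
    and "B = of_nat (((m + 1) * Suc k) choose k)"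
  have "Suc k * (((m + 1) * Suc k) choose Suc k) = (m * Suc k + 1) * (((m + 1) * Suc k) choose k)"
    using Suc_times_binomial_add [of k "m * Suc k"] by (simp add: add_ac)
  then have absorb: "of_nat (Suc k) * A = of_nat (m * Suc k + 1) * B"
    unfolding A_def B_def by (simp only: flip: of_nat_mult)
  have "(A - of_nat m * B) * of_nat (m * Suc k + 1)
      = of_nat (m * Suc k + 1) * A - of_nat m * (of_nat (m * Suc k + 1) * B)"
    by (simp only: left_diff_distrib mult_ac)
  also have "\<dots> = A"
    unfolding absorb [symmetric] by (simp add: algebra_simps)
  finally have "A - of_nat m * B = A / of_nat (m * Suc k + 1)"
    by (simp only: nonzero_eq_divide_eq of_nat_eq_0_iff)
  then show ?thesis
    by (simp only: fuss_catalan_def A_def B_def)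
qed

section \<open>Congruences between rationals modulo a prime\<close>

lemma of_int_divide_in_D:
  assumes "\<not> int p dvd b"
  shows "of_int a / of_int b \<in> D p"
proof -
  obtain c d where q: "quotient_of (of_int a / of_int b) = (c, d)"
    by fastforce
  have "d > 0" "coprime c d" and eq: "of_int a / of_int b = (of_int c / of_int d :: rat)"
    using quotient_of_denom_pos [OF q] quotient_of_coprime [OF q] quotient_of_div [OF q] by simp_all
  moreover have "b \<noteq> 0" using assms by auto
  ultimately have "of_int (a * d) = (of_int (c * b) :: rat)"
    by (simp add: field_simps)
  then have "d dvd c * b"
    by (metis dvd_triv_right of_int_eq_iff)
  then have "d dvd b"
    using \<open>coprime c d\<close> by (simp add: coprime_commute coprime_dvd_mult_right_iff)
  then show ?thesis
    using assms dvd_trans by (auto simp: D_def q)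
qed

lemma in_D_cases:
  assumes "x \<in> D p"
  obtains a b where "quotient_of x = (a, b)" "x = of_int a / of_int b" "\<not> int p dvd b" "b \<noteq> 0"
proof -
  obtain a b where q: "quotient_of x = (a, b)"
    by fastforce
  then show ?thesis
    using that [of a b] assms quotient_of_div [OF q] quotient_of_denom_pos [OF q]
    by (simp add: D_def)
qed

locale prime_modulus =
  fixes p :: nat
  assumes prime: "prime p"
begin

lemma not_dvd_mult: "\<not> int p dvd a \<Longrightarrow> \<not> int p dvd b \<Longrightarrow> \<not> int p dvd a * b"
  using prime by (simp add: prime_dvd_mult_iff)

lemma D_of_int [simp]: "of_int a \<in> D p"
  using prime_gt_1_nat [OF prime] by (simp add: D_def)

lemma D_of_nat [simp]: "of_nat n \<in> D p"
  using D_of_int [of "int n"] by simp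

lemma D_numeral [simp]: "0 \<in> D p" "1 \<in> D p" "numeral k \<in> D p"
  using D_of_nat [of 0] D_of_nat [of 1] D_of_nat [of "numeral k"] by simp_all

lemma D_add [simp]: "x \<in> D p \<Longrightarrow> y \<in> D p \<Longrightarrow> x + y \<in> D p"
proof (elim in_D_cases)
  fix a b c d
  assume "x = of_int a / of_int b" "y = of_int c / of_int d" "b \<noteq> 0" "d \<noteq> 0"
    and ndvd: "\<not> int p dvd b" "\<not> int p dvd d"
  then have "x + y = of_int (a * d + c * b) / of_int (b * d)"
    by (simp add: field_simps)
  then show ?thesis
    using ndvd by (simp only: of_int_divide_in_D not_dvd_mult not_False_eq_True)
qed

lemma D_mult [simp]: "x \<in> D p \<Longrightarrow> y \<in> D p \<Longrightarrow> x * y \<in> D p"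
proof (elim in_D_cases)
  fix a b c d
  assume "x = of_int a / of_int b" "y = of_int c / of_int d"
    and ndvd: "\<not> int p dvd b" "\<not> int p dvd d"
  then have "x * y = of_int (a * c) / of_int (b * d)"
    by simp
  then show ?thesis
    using ndvd by (simp only: of_int_divide_in_D not_dvd_mult not_False_eq_True)
qed

lemma D_uminus [simp]: "x \<in> D p \<Longrightarrow> - x \<in> D p"
  using D_mult [OF D_of_int [of "-1"]] by simp

lemma D_diff [simp]: "x \<in> D p \<Longrightarrow> y \<in> D p \<Longrightarrow> x - y \<in> D p"
  using D_add [of x "- y"] by simp

lemma D_power [simp]: "x \<in> D p \<Longrightarrow> x ^ n \<in> D p"
  by (induction n) simp_all

lemma D_prod [simp]: "(\<And>i. i \<in> A \<Longrightarrow> f i \<in> D p) \<Longrightarrow> prod f A \<in> D p"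
  by (induction A rule: infinite_finite_induct) simp_all

lemma rat_cong_refl [simp]: "rat_cong p x x"
  by (auto simp: rat_cong_def intro!: bexI [of _ 0])

lemma rat_cong_sym: "rat_cong p x y \<Longrightarrow> rat_cong p y x"
  unfolding rat_cong_def by (metis D_uminus minus_diff_eq mult_minus_right)

lemma rat_cong_add: "rat_cong p x x' \<Longrightarrow> rat_cong p y y' \<Longrightarrow> rat_cong p (x + y) (x' + y')"
  unfolding rat_cong_def by (metis D_add add_diff_add distrib_left)

lemma rat_cong_trans [trans]: "rat_cong p x y \<Longrightarrow> rat_cong p y w \<Longrightarrow> rat_cong p x w"
  using rat_cong_add [of x y y w] by (simp add: rat_cong_def)

lemma rat_cong_mult_left: "rat_cong p x y \<Longrightarrow> c \<in> D p \<Longrightarrow> rat_cong p (c * x) (c * y)"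
  unfolding rat_cong_def by (metis D_mult mult.left_commute right_diff_distrib)

lemma rat_cong_mult_right: "rat_cong p x y \<Longrightarrow> c \<in> D p \<Longrightarrow> rat_cong p (x * c) (y * c)"
  using rat_cong_mult_left [of x y c] by (simp add: mult.commute)

lemma rat_cong_mult:
  assumes "rat_cong p x x'" "rat_cong p y y'" "x' \<in> D p" "y \<in> D p"
  shows "rat_cong p (x * y) (x' * y')"
  using assms by (blast intro: rat_cong_trans rat_cong_mult_left rat_cong_mult_right)

lemma rat_cong_uminus: "rat_cong p x y \<Longrightarrow> rat_cong p (- x) (- y)"
  using rat_cong_mult_left [OF _ D_of_int [of "-1"]] by simp

lemma rat_cong_diff: "rat_cong p x x' \<Longrightarrow> rat_cong p y y' \<Longrightarrow> rat_cong p (x - y) (x' - y')"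
  using rat_cong_add [OF _ rat_cong_uminus] by simp

lemma rat_cong_in_D: "rat_cong p x y \<Longrightarrow> y \<in> D p \<Longrightarrow> x \<in> D p"
  unfolding rat_cong_def by (metis D_add D_mult D_of_nat diff_add_cancel)

lemma rat_cong_power: "rat_cong p x y \<Longrightarrow> y \<in> D p \<Longrightarrow> rat_cong p (x ^ n) (y ^ n)"
  by (induction n) (auto intro!: rat_cong_mult dest: rat_cong_in_D)

lemma rat_cong_sum:
  "(\<And>i. i \<in> A \<Longrightarrow> rat_cong p (f i) (g i)) \<Longrightarrow> rat_cong p (sum f A) (sum g A)"
  by (induction A rule: infinite_finite_induct) (auto intro!: rat_cong_add)

lemma rat_cong_prod:
  "(\<And>i. i \<in> A \<Longrightarrow> rat_cong p (f i) (g i)) \<Longrightarrow> (\<And>i. i \<in> A \<Longrightarrow> g i \<in> D p) \<Longrightarrow>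
    rat_cong p (prod f A) (prod g A)"
  by (induction A rule: infinite_finite_induct)
    (auto intro!: rat_cong_mult dest: rat_cong_in_D)

lemma rat_cong_of_int_iff: "rat_cong p (of_int a) (of_int b) \<longleftrightarrow> [a = b] (mod int p)"
proof
  assume "rat_cong p (of_int a) (of_int b)"
  then obtain w where w: "w \<in> D p" "of_int (a - b) = of_nat p * w"
    by (auto simp: rat_cong_def)
  then obtain c d where cd: "w = of_int c / of_int d" "\<not> int p dvd d" "d \<noteq> 0"
    by (elim in_D_cases)
  then have "of_int ((a - b) * d) = (of_int (int p * c) :: rat)"
    using w by (simp add: field_simps)
  then have "int p dvd (a - b) * d"
    by (metis dvd_triv_left of_int_eq_iff)
  then show "[a = b] (mod int p)"
    using not_dvd_mult cd by (auto simp: cong_iff_dvd_diff)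
next
  assume "[a = b] (mod int p)"
  then obtain c where "a - b = int p * c"
    by (auto simp: cong_iff_dvd_diff)
  then have "of_int a - of_int b = (of_nat p * of_int c :: rat)"
    by (metis of_int_diff of_int_mult of_int_of_nat_eq)
  then show "rat_cong p (of_int a) (of_int b)"
    by (auto simp: rat_cong_def)
qed

lemma rat_cong_of_nat_iff: "rat_cong p (of_nat a) (of_nat b) \<longleftrightarrow> [a = b] (mod p)"
  using rat_cong_of_int_iff [of "int a" "int b"] by (simp add: cong_int_iff)

lemma rat_cong_of_nat_0_iff: "rat_cong p (of_nat a) 0 \<longleftrightarrow> p dvd a"
  using rat_cong_of_nat_iff [of a 0] by (simp add: cong_0_iff)

lemma inverse_in_D:
  assumes "x \<in> D p" "\<not> rat_cong p x 0"
  shows "inverse x \<in> D p"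
proof -
  obtain a b where ab: "x = of_int a / of_int b" "\<not> int p dvd b" "b \<noteq> 0"
    using assms(1) by (rule in_D_cases)
  have "\<not> int p dvd a"
  proof
    assume "int p dvd a"
    then obtain c where "a = int p * c" by blast
    then have "x = of_nat p * (of_int c / of_int b)" using ab by simp
    then show False using assms(2) ab of_int_divide_in_D [of p b c] by (auto simp: rat_cong_def)
  qed
  then show ?thesis using ab of_int_divide_in_D [of p a b] by simp
qed

lemma rat_cong_divideI:
  assumes "rat_cong p (x * y) w" "x \<in> D p" "\<not> rat_cong p x 0"
  shows "rat_cong p y (w / x)"
proof -
  have "x \<noteq> 0" using assms(3) by auto
  then show ?thesis
    using rat_cong_mult_left [OF assms(1) inverse_in_D [OF assms(2,3)]]
    by (simp add: field_simps)
qed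

lemma rat_cong_mult_lcancel:
  assumes "rat_cong p (x * y) (x * w)" "x \<in> D p" "\<not> rat_cong p x 0"
  shows "rat_cong p y w"
  using rat_cong_divideI [OF assms] assms(3) by (cases "x = 0") auto

lemma not_rat_cong_0_mult:
  assumes "x \<in> D p" "\<not> rat_cong p x 0" "\<not> rat_cong p y 0"
  shows "\<not> rat_cong p (x * y) 0"
  using rat_cong_mult_lcancel [of x y 0] assms by auto

lemma in_D_rat_cong_of_nat:
  assumes "x \<in> D p"
  obtains n where "rat_cong p x (of_nat n)"
proof -
  obtain a b where ab: "x = of_int a / of_int b" "\<not> int p dvd b" "b \<noteq> 0"
    using assms by (rule in_D_cases)
  have "coprime b (int p)"
    using prime ab(2) by (metis coprime_commute prime_imp_coprime prime_nat_int_transfer)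
  then obtain c where "[b * c = 1] (mod int p)"
    using cong_solve_coprime_int by blast
  then have "[a = b * (a * c)] (mod int p)"
    by (metis cong_scalar_left cong_sym mult.left_commute mult.right_neutral)
  then have "[a = b * (a * c mod int p)] (mod int p)"
    by (simp add: cong_def mod_mult_right_eq)
  moreover define n where "n = nat (a * c mod int p)"
  ultimately have "[a = b * int n] (mod int p)"
    using prime_gt_0_nat [OF prime] by simp
  then have "rat_cong p (of_int b * x) (of_int b * of_nat n)"
    using ab rat_cong_of_int_iff [of a "b * int n"] by simp
  moreover have "\<not> rat_cong p (of_int b) 0"
    using ab(2) rat_cong_of_int_iff [of b 0] by (simp add: cong_0_iff)
  ultimately show ?thesis
    using that [of n] rat_cong_mult_lcancel by auto
qed

lemma rat_fermat:
  assumes "x \<in> D p" "\<not> rat_cong p x 0"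
  shows "rat_cong p (x ^ (p - 1)) 1"
proof -
  obtain n where n: "rat_cong p x (of_nat n)"
    using assms(1) by (rule in_D_rat_cong_of_nat)
  then have "\<not> rat_cong p (of_nat n) 0"
    using assms(2) rat_cong_trans by blast
  then have "[n ^ (p - 1) = 1] (mod p)"
    using fermat_theorem [OF prime] by (simp add: rat_cong_of_nat_0_iff)
  then have "rat_cong p (of_nat n ^ (p - 1)) 1"
    using rat_cong_of_nat_iff [of "n ^ (p - 1)" 1] by simp
  with rat_cong_power [OF n] show ?thesis
    by (rule rat_cong_trans) simp
qed

lemma rat_fermat':
  assumes "x \<in> D p"
  shows "rat_cong p (x ^ p) x"
proof -
  have eq: "x ^ p = x * x ^ (p - 1)"
    using prime_gt_0_nat [OF prime] by (simp add: power_eq_if)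
  show ?thesis
  proof (cases "rat_cong p x 0")
    case True
    then have "rat_cong p (x * x ^ (p - 1)) 0"
      using rat_cong_mult_right [OF True, of "x ^ (p - 1)"] assms by simp
    also have "rat_cong p 0 x"
      using True by (rule rat_cong_sym)
    finally show ?thesis unfolding eq .
  next
    case False
    then show ?thesis
      unfolding eq using rat_cong_mult_left [OF rat_fermat [OF assms False] assms] by simp
  qed
qed

lemma rat_euler_criterion:
  assumes "2 < p" "x \<in> D p"
  shows "rat_cong p (x ^ (p div 2)) (of_int (rat_Legendre x p))"
proof -
  have "odd p"
    using prime assms(1) by (simp add: prime_odd_nat)
  then have half: "p div 2 = (p - 1) div 2" "2 * (p div 2) = p - 1"
    by (auto elim!: oddE)
  obtain a b where ab: "quotient_of x = (a, b)" "x = of_int a / of_int b" "\<not> int p dvd b" "b \<noteq> 0"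
    using assms(2) by (rule in_D_cases)
  have b: "\<not> rat_cong p (of_int b) 0"
    using ab(3) rat_cong_of_int_iff [of b 0] by (simp add: cong_0_iff)
  have "rat_cong p (of_int (rat_Legendre x p)) (of_int ((a * b) ^ (p div 2)))"
    unfolding rat_Legendre_def ab(1) fst_conv snd_conv rat_cong_of_int_iff half(1)
    using prime assms(1) by (rule euler_criterion)
  also have "of_int ((a * b) ^ (p div 2)) = (x * of_int b ^ 2) ^ (p div 2)"
    using ab by (simp add: power2_eq_square)
  also have "\<dots> = x ^ (p div 2) * of_int b ^ (p - 1)"
    by (simp only: power_mult_distrib half(2) flip: power_mult)
  also have "rat_cong p \<dots> (x ^ (p div 2) * 1)"
    using rat_fermat [OF D_of_int b] assms by (intro rat_cong_mult_left) auto
  finally show ?thesis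
    using rat_cong_sym by simp
qed

section \<open>Lucas sequences modulo a prime\<close>

lemma rat_cong_binomial_transform:
  assumes "a \<in> D p" "\<And>i. w i \<in> D p"
  shows "rat_cong p (binomial_transform a w p) (a * w 0 + w p)"
proof -
  obtain q where q: "p = Suc q"
    using prime by (cases p) auto
  let ?inner = "\<lambda>i. of_nat (p choose Suc i) * a ^ (q - i) * w (Suc i)"
  have "rat_cong p (?inner i) 0" if "i < q" for i
  proof -
    have "p dvd p choose Suc i"
      using prime q that by (intro dvd_choose_prime) auto
    then have "rat_cong p (of_nat (p choose Suc i)) 0"
      by (simp add: rat_cong_of_nat_0_iff)
    then show ?thesis
      using rat_cong_mult_right [of _ 0 "a ^ (q - i) * w (Suc i)"] assms by (simp add: mult.assoc)
  qed
  then have inner: "rat_cong p (\<Sum>i<q. ?inner i) 0"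
    using rat_cong_sum [of "{..<q}" ?inner "\<lambda>_. 0"] by simp
  have "binomial_transform a w p = a ^ p * w 0 + (\<Sum>i\<le>q. ?inner i)"
    unfolding binomial_transform_def q by (subst sum.atMost_Suc_shift) simp
  also have "\<dots> = a ^ p * w 0 + (\<Sum>i<q. ?inner i) + w p"
    by (simp add: q flip: lessThan_Suc_atMost)
  also have "rat_cong p \<dots> (a * w 0 + 0 + w p)"
    using assms by (intro rat_cong_add rat_cong_mult_right rat_fermat' inner) auto
  finally show ?thesis by simp
qed

lemma not_rat_cong_2_0: "2 < p \<Longrightarrow> \<not> rat_cong p 2 0"
  using rat_cong_of_nat_0_iff [of 2] by (auto dest: dvd_imp_le)

lemma lucas_in_D [simp]:
  assumes "a \<in> D p" "b \<in> D p"
  shows "lucas_U a b n \<in> D p" "lucas_V a b n \<in> D p"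
  using assms by (induction n rule: induct_nat_012) simp_all

lemma parity_powers_in_D [simp]:
  assumes "d \<in> D p"
  shows "even_powers d i \<in> D p" "odd_powers d i \<in> D p"
  using assms by (simp_all add: even_powers_def odd_powers_def)

lemma lucas_prime:
  assumes "2 < p" and ab: "a \<in> D p" "b \<in> D p"
  shows lucas_V_prime: "rat_cong p (lucas_V a b p) a"
    and lucas_U_prime: "rat_cong p (lucas_U a b p) (of_int (rat_Legendre (a\<^sup>2 - 4 * b) p))"
proof -
  let ?d = "a\<^sup>2 - 4 * b"
  have "odd p"
    using prime assms(1) by (simp add: prime_odd_nat)
  have d: "?d \<in> D p"
    using ab by simp
  have fermat_2: "rat_cong p (2 * x) (2 ^ p * x)" if "x \<in> D p" for x
    using that by (intro rat_cong_mult_right rat_cong_sym [OF rat_fermat']) simp_all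
  have "rat_cong p (2 * lucas_V a b p) (2 ^ p * lucas_V a b p)"
    using ab by (intro fermat_2) simp
  also have "\<dots> = 2 * binomial_transform a (even_powers ?d) p"
    by (rule lucas_eq_binomial_transform)
  also have "rat_cong p \<dots> (2 * (a * even_powers ?d 0 + even_powers ?d p))"
    using ab d by (intro rat_cong_mult_left rat_cong_binomial_transform) simp_all
  also have "\<dots> = 2 * a"
    using \<open>odd p\<close> by (simp add: even_powers_def)
  finally show "rat_cong p (lucas_V a b p) a"
    by (rule rat_cong_mult_lcancel [of 2]) (simp_all add: not_rat_cong_2_0 [OF assms(1)])
  have "rat_cong p (2 * lucas_U a b p) (2 ^ p * lucas_U a b p)"
    using ab by (intro fermat_2) simp
  also have "\<dots> = 2 * binomial_transform a (odd_powers ?d) p"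
    by (rule lucas_eq_binomial_transform)
  also have "rat_cong p \<dots> (2 * (a * odd_powers ?d 0 + odd_powers ?d p))"
    using ab d by (intro rat_cong_mult_left rat_cong_binomial_transform) simp_all
  also have "\<dots> = 2 * ?d ^ (p div 2)"
    using \<open>odd p\<close> by (simp add: odd_powers_def)
  also have "rat_cong p \<dots> (2 * of_int (rat_Legendre ?d p))"
    using assms(1) d by (intro rat_cong_mult_left rat_euler_criterion) simp_all
  finally show "rat_cong p (lucas_U a b p) (of_int (rat_Legendre ?d p))"
    by (rule rat_cong_mult_lcancel [of 2]) (simp_all add: not_rat_cong_2_0 [OF assms(1)])
qed

lemma lucas_double_prime:
  assumes "2 < p" and ab: "a \<in> D p" "b \<in> D p"
  shows "rat_cong p (lucas_V a b (2 * p)) (a\<^sup>2 - 2 * b)"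
    and "rat_cong p (lucas_U a b (2 * p)) (a * of_int (rat_Legendre (a\<^sup>2 - 4 * b) p))"
proof -
  show "rat_cong p (lucas_V a b (2 * p)) (a\<^sup>2 - 2 * b)"
    unfolding lucas_V_double using assms
    by (intro rat_cong_diff rat_cong_power rat_cong_mult_left lucas_V_prime rat_fermat') simp_all
  show "rat_cong p (lucas_U a b (2 * p)) (a * of_int (rat_Legendre (a\<^sup>2 - 4 * b) p))"
    unfolding lucas_U_double mult.commute [of a] using assms
    by (intro rat_cong_mult lucas_U_prime lucas_V_prime) simp_all
qed

section \<open>Sums of binomial coefficients modulo a prime\<close>

lemma rat_cong_fact_0_iff: "rat_cong p (fact k) 0 \<longleftrightarrow> p \<le> k"
  using rat_cong_of_nat_0_iff [of "fact k"] prime_dvd_fact_iff [OF prime] by simp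

lemma rat_cong_gbinomial:
  fixes x y :: rat
  assumes "k < p" "rat_cong p x y" "y \<in> D p"
  shows "rat_cong p (x gchoose k) (y gchoose k)"
proof -
  have "rat_cong p (\<Prod>i = 0..<k. x - of_nat i) (\<Prod>i = 0..<k. y - of_nat i)"
    using assms by (intro rat_cong_prod rat_cong_diff) auto
  then have "rat_cong p (fact k * (x gchoose k)) (fact k * (y gchoose k))"
    by (simp add: gbinomial_mult_fact)
  then show ?thesis
    using assms(1) D_of_nat [of "fact k"]
    by (elim rat_cong_mult_lcancel) (simp_all add: rat_cong_fact_0_iff)
qed

lemma rat_cong_binomial_reflect:
  assumes "k < p" "[m + n + 1 = k] (mod p)"
  shows "rat_cong p (of_nat (m choose k)) ((-1) ^ k * of_nat (n choose k))"
proof -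
  have "rat_cong p (of_nat k - (of_nat m + 1)) (of_nat (m + n + 1) - (of_nat m + 1))"
    using assms(2) by (intro rat_cong_diff rat_cong_refl) (simp only: rat_cong_of_nat_iff cong_sym)
  then have "rat_cong p (of_nat k - of_nat m - 1) (of_nat n)"
    by (simp add: algebra_simps)
  then have "rat_cong p ((of_nat k - of_nat m - 1) gchoose k) (of_nat n gchoose k)"
    using assms(1) by (intro rat_cong_gbinomial) auto
  then have "rat_cong p ((-1) ^ k * ((of_nat k - of_nat m - 1) gchoose k))
      ((-1) ^ k * (of_nat n gchoose k))"
    by (rule rat_cong_mult_left) simp
  then show ?thesis
    by (simp add: binomial_gbinomial gbinomial_negated_upper [of "of_nat m"])
qed

lemma rat_cong_sum_binomial_shifted:
  assumes "z \<in> D p" "p dvd n" "K < p" "m * K + r < n" "n \<le> (m + 1) * (K + 1) + r"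
  shows "rat_cong p (\<Sum>k\<le>K. of_nat (((m + 1) * k + r) choose k) * z ^ k)
     (diagonal_sum m (- z) (n - 1 - r))"
proof -
  have "rat_cong p (of_nat (((m + 1) * k + r) choose k) * z ^ k)
      (of_nat ((n - 1 - r - m * k) choose k) * (- z) ^ k)" if "k \<le> K" for k
  proof -
    have "m * k + r < n"
      using assms(4) that by (meson add_le_mono1 le_less_trans mult_le_mono2)
    then have "(m + 1) * k + r + (n - 1 - r - m * k) + 1 = n + k"
      by simp
    then have "[(m + 1) * k + r + (n - 1 - r - m * k) + 1 = k] (mod p)"
      using assms(2) by (simp only: cong_add_rcancel_0_nat cong_0_iff)
    then have "rat_cong p (of_nat (((m + 1) * k + r) choose k))
        ((-1) ^ k * of_nat ((n - 1 - r - m * k) choose k))"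
      using assms(3) that by (intro rat_cong_binomial_reflect) auto
    then have "rat_cong p (of_nat (((m + 1) * k + r) choose k) * z ^ k)
        ((-1) ^ k * of_nat ((n - 1 - r - m * k) choose k) * z ^ k)"
      using assms(1) by (intro rat_cong_mult_right) simp_all
    then show ?thesis
      by (simp only: power_minus [of z] mult_ac)
  qed
  moreover have "n - 1 - r < (m + 1) * (K + 1)"
    using assms(4,5) by simp
  ultimately show ?thesis
    by (auto simp: diagonal_sum_eq intro!: rat_cong_sum)
qed

lemma rat_cong_sum_binomial:
  assumes "z \<in> D p" "p dvd n" "K < p" "m * K < n" "n \<le> (m + 1) * (K + 1)"
  shows "rat_cong p (\<Sum>k = 1..K. of_nat (((m + 1) * k) choose k) * z ^ k)
     (diagonal_sum m (- z) (n - 1) - 1)"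
proof -
  have "(\<Sum>k = 1..K. of_nat (((m + 1) * k) choose k) * z ^ k)
      = (\<Sum>k\<le>K. of_nat (((m + 1) * k) choose k) * z ^ k) - 1"
    by (simp add: atMost_atLeast0 sum.atLeast_Suc_atMost)
  then show ?thesis
    using rat_cong_diff [OF rat_cong_sum_binomial_shifted [of z n K m 0] rat_cong_refl [of 1]] assms
    by simp
qed

lemma rat_cong_sum_fuss_catalan:
  assumes "z \<in> D p" "p dvd n" "0 < K" "K < p" "m * K + 1 < n" "n \<le> (m + 1) * (K + 1)"
  shows "rat_cong p (\<Sum>k = 1..K. fuss_catalan m k * z ^ k)
     (of_nat (m + 1) * diagonal_sum m (- z) (n - 1) - of_nat m * diagonal_sum m (- z) (n - 2) - 1)"
proof -
  let ?d = "diagonal_sum m (- z)"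
  obtain J where J: "K = Suc J"
    using assms(3) by (cases K) auto
  let ?S = "\<Sum>k\<le>J. of_nat (((m + 1) * Suc k) choose k) * z ^ k"
  have "m + 2 \<le> n"
    using assms(5) J by simp
  then have "n - 1 = (n - 1 - (m + 1)) + m + 1" "n - 2 = (n - 1 - (m + 1)) + m"
    by simp_all
  then have rec: "z * ?d (n - 1 - (m + 1)) = ?d (n - 2) - ?d (n - 1)"
    using diagonal_sum_rec [of m "- z" "n - 1 - (m + 1)"] by simp
  have "rat_cong p (\<Sum>k\<le>J. of_nat (((m + 1) * k + (m + 1)) choose k) * z ^ k) (?d (n - 1 - (m + 1)))"
    using assms J by (intro rat_cong_sum_binomial_shifted) (auto simp: algebra_simps)
  then have S: "rat_cong p ?S (?d (n - 1 - (m + 1)))"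
    by (simp only: mult_Suc_right add.commute)
  have "(\<Sum>k = 1..K. fuss_catalan m k * z ^ k)
      = (\<Sum>k\<le>J. of_nat (((m + 1) * Suc k) choose Suc k) * z ^ Suc k) - of_nat m * (z * ?S)"
    unfolding J One_nat_def sum.shift_bounds_cl_Suc_ivl atLeast0AtMost fuss_catalan_Suc
    by (simp only: left_diff_distrib sum_subtractf sum_distrib_left power_Suc) (simp only: mult_ac)
  also have "(\<Sum>k\<le>J. of_nat (((m + 1) * Suc k) choose Suc k) * z ^ Suc k)
      = (\<Sum>k = 1..K. of_nat (((m + 1) * k) choose k) * z ^ k)"
    unfolding J One_nat_def sum.shift_bounds_cl_Suc_ivl atLeast0AtMost ..
  also have "rat_cong p (\<dots> - of_nat m * (z * ?S))
      ((?d (n - 1) - 1) - of_nat m * (z * ?d (n - 1 - (m + 1))))"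
    using assms by (intro rat_cong_diff rat_cong_mult_left rat_cong_sum_binomial S) simp_all
  finally show ?thesis
    unfolding rec by (simp add: algebra_simps)
qed

lemma rat_cong_sum_binomial_lucas:
  assumes "t \<in> D p" "\<not> rat_cong p (3 * t + 2) 0"
    and n: "p dvd n" "2 < p" "K < p" "2 * K < n" "n \<le> 3 * (K + 1)"
    and u: "rat_cong p (lucas_U (t + 1) (t * (t + 1)) n) u"
    and v: "rat_cong p (lucas_V (t + 1) (t * (t + 1)) n) v"
    and w: "rat_cong p ((- t) ^ n) w"
  shows "rat_cong p (\<Sum>k = 1..K. of_nat ((3 * k) choose k) * (t\<^sup>2 * (t + 1)) ^ k)
    ((3 * (t + 1) * u + v - 2 * w - 2 * (3 * t + 2)) / (2 * (3 * t + 2)))"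
proof (rule rat_cong_divideI)
  let ?z = "t\<^sup>2 * (t + 1)"
  obtain j where j: "n = Suc j"
    using n by (cases n) auto
  have "rat_cong p (2 * (3 * t + 2) * (\<Sum>k = 1..K. of_nat ((3 * k) choose k) * ?z ^ k))
      (2 * (3 * t + 2) * (diagonal_sum 2 (- ?z) j - 1))"
    using rat_cong_sum_binomial [of ?z n K 2] assms(1) n
    by (intro rat_cong_mult_left) (simp_all add: j)
  also have "\<dots> = 3 * (t + 1) * lucas_U (t + 1) (t * (t + 1)) n + lucas_V (t + 1) (t * (t + 1)) n
      - 2 * (- t) ^ n - 2 * (3 * t + 2)"
    by (simp only: right_diff_distrib mult_1_right diagonal_sum_2_closed_form j)
  also have "rat_cong p \<dots> (3 * (t + 1) * u + v - 2 * w - 2 * (3 * t + 2))"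
    using assms(1) u v w by (intro rat_cong_diff rat_cong_add rat_cong_mult_left) simp_all
  finally show "rat_cong p (2 * (3 * t + 2) * (\<Sum>k = 1..K. of_nat ((3 * k) choose k) * ?z ^ k))
      (3 * (t + 1) * u + v - 2 * w - 2 * (3 * t + 2))" .
  show "2 * (3 * t + 2) \<in> D p" "\<not> rat_cong p (2 * (3 * t + 2)) 0"
    using assms(1,2) n(2) not_rat_cong_2_0 by (simp, intro not_rat_cong_0_mult) simp_all
qed

lemma rat_cong_sum_catalan2_lucas:
  assumes "t \<in> D p" "\<not> rat_cong p t 0"
    and n: "p dvd n" "2 < p" "0 < K" "K < p" "2 * K + 1 < n" "n \<le> 3 * (K + 1)"
    and u: "rat_cong p (lucas_U (t + 1) (t * (t + 1)) n) u"
    and v: "rat_cong p (lucas_V (t + 1) (t * (t + 1)) n) v"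
    and w: "rat_cong p ((- t) ^ n) w"
  shows "rat_cong p (\<Sum>k = 1..K. catalan2 k * (t\<^sup>2 * (t + 1)) ^ k)
    (((3 * t - 1) * u + v - 2 * w - 2 * t) / (2 * t))"
proof (rule rat_cong_divideI)
  let ?z = "t\<^sup>2 * (t + 1)"
  obtain j where j: "n = Suc (Suc j)"
    using n by (cases n; cases "n - 1") auto
  have "rat_cong p (2 * t * (\<Sum>k = 1..K. catalan2 k * ?z ^ k))
      (2 * t * (3 * diagonal_sum 2 (- ?z) (Suc j) - 2 * diagonal_sum 2 (- ?z) j - 1))"
    unfolding catalan2_eq_fuss_catalan
    using rat_cong_sum_fuss_catalan [of ?z n K 2] assms(1) n
    by (intro rat_cong_mult_left) (simp_all add: j)
  also have "\<dots> = (3 * t - 1) * lucas_U (t + 1) (t * (t + 1)) n + lucas_V (t + 1) (t * (t + 1)) n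
      - 2 * (- t) ^ n - 2 * t"
    by (simp only: right_diff_distrib [of _ _ 1] mult_1_right diagonal_sum_2_catalan_closed_form j)
  also have "rat_cong p \<dots> ((3 * t - 1) * u + v - 2 * w - 2 * t)"
    using assms(1) u v w by (intro rat_cong_diff rat_cong_add rat_cong_mult_left) simp_all
  finally show "rat_cong p (2 * t * (\<Sum>k = 1..K. catalan2 k * ?z ^ k))
      ((3 * t - 1) * u + v - 2 * w - 2 * t)" .
  show "2 * t \<in> D p" "\<not> rat_cong p (2 * t) 0"
    using assms(1,2) n(2) not_rat_cong_2_0 by (simp, intro not_rat_cong_0_mult) simp_all
qed

lemma lucas_quadratic_factor:
  assumes "2 < p" "t \<in> D p"
  defines "L \<equiv> of_int (rat_Legendre ((1 + t) * (1 - 3 * t)) p)"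
  shows "rat_cong p (lucas_U (t + 1) (t * (t + 1)) p) L"
    and "rat_cong p (lucas_V (t + 1) (t * (t + 1)) p) (t + 1)"
    and "rat_cong p (lucas_U (t + 1) (t * (t + 1)) (2 * p)) ((t + 1) * L)"
    and "rat_cong p (lucas_V (t + 1) (t * (t + 1)) (2 * p)) ((t + 1) * (1 - t))"
proof -
  have discriminant: "(t + 1)\<^sup>2 - 4 * (t * (t + 1)) = (1 + t) * (1 - 3 * t)"
    and sum_root_squares: "(t + 1)\<^sup>2 - 2 * (t * (t + 1)) = (t + 1) * (1 - t)"
    by (simp_all add: algebra_simps power2_eq_square)
  have D: "t + 1 \<in> D p" "t * (t + 1) \<in> D p"
    using assms(2) by simp_all
  note at_p = lucas_prime [OF assms(1) D, unfolded discriminant, folded L_def]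
    and at_2p = lucas_double_prime
      [OF assms(1) D, unfolded discriminant sum_root_squares, folded L_def]
  show "rat_cong p (lucas_U (t + 1) (t * (t + 1)) p) L"
    "rat_cong p (lucas_V (t + 1) (t * (t + 1)) p) (t + 1)"
    "rat_cong p (lucas_U (t + 1) (t * (t + 1)) (2 * p)) ((t + 1) * L)"
    "rat_cong p (lucas_V (t + 1) (t * (t + 1)) (2 * p)) ((t + 1) * (1 - t))"
    by (fact at_p at_2p)+
qed

lemma rat_fermat_double:
  assumes "x \<in> D p"
  shows "rat_cong p (x ^ (2 * p)) (x\<^sup>2)"
  using rat_cong_power [OF rat_fermat' [OF assms] assms, of 2]
  by (simp add: mult.commute flip: power_mult)

lemma rat_cong_sum_catalan2_div_3:
  assumes "3 < p" "t \<in> D p" "\<not> rat_cong p t 0"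
  defines "L \<equiv> of_int (rat_Legendre ((1 + t) * (1 - 3 * t)) p)"
  shows "rat_cong p (\<Sum>k = 1..p div 3. catalan2 k * (t\<^sup>2 * (t + 1)) ^ k)
    ((1 + t) / (2 * t) - (1 - 3 * t) / (2 * t) * L)"
proof -
  have "rat_cong p (\<Sum>k = 1..p div 3. catalan2 k * (t\<^sup>2 * (t + 1)) ^ k)
      (((3 * t - 1) * L + (t + 1) - 2 * (- t) - 2 * t) / (2 * t))"
    unfolding L_def using assms(1-3)
    by (intro rat_cong_sum_catalan2_lucas [where n = p] lucas_quadratic_factor
        rat_fermat') auto
  also have "(3 * t - 1) * L + (t + 1) - 2 * (- t) - 2 * t
      = (1 + t) - (1 - 3 * t) * L"
    by (simp add: algebra_simps)
  finally show ?thesis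
    by (simp only: times_divide_eq_left flip: diff_divide_distrib)
qed

lemma rat_cong_sum_catalan2_full:
  assumes "3 < p" "t \<in> D p" "\<not> rat_cong p t 0"
  defines "L \<equiv> of_int (rat_Legendre ((1 + t) * (1 - 3 * t)) p)"
  shows "rat_cong p (\<Sum>k = 1..p - 1. catalan2 k * (t\<^sup>2 * (t + 1)) ^ k)
    ((1 + t) * (1 - 3 * t) / (2 * t) * (1 - L))"
proof -
  have "rat_cong p (\<Sum>k = 1..p - 1. catalan2 k * (t\<^sup>2 * (t + 1)) ^ k)
      (((3 * t - 1) * ((t + 1) * L) + (t + 1) * (1 - t) - 2 * (- t)\<^sup>2 - 2 * t) / (2 * t))"
    unfolding L_def using assms(1-3)
    by (intro rat_cong_sum_catalan2_lucas [where n = "2 * p"] lucas_quadratic_factor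
        rat_fermat_double) auto
  also have "(3 * t - 1) * ((t + 1) * L) + (t + 1) * (1 - t) - 2 * (- t)\<^sup>2 - 2 * t
      = (1 + t) * (1 - 3 * t) * (1 - L)"
    by (simp add: algebra_simps power2_eq_square)
  finally show ?thesis
    by (simp only: times_divide_eq_left)
qed

lemma rat_cong_sum_binomial_div_3:
  assumes "3 < p" "t \<in> D p" "\<not> rat_cong p (3 * t + 2) 0"
  defines "L \<equiv> of_int (rat_Legendre ((1 + t) * (1 - 3 * t)) p)"
  shows "rat_cong p (\<Sum>k = 1..p div 3. of_nat ((3 * k) choose k) * (t\<^sup>2 * (t + 1)) ^ k)
    (3 * (t + 1) / (2 * (3 * t + 2)) * (L - 1))"
proof -
  have "rat_cong p (\<Sum>k = 1..p div 3. of_nat ((3 * k) choose k) * (t\<^sup>2 * (t + 1)) ^ k)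
      ((3 * (t + 1) * L + (t + 1) - 2 * (- t) - 2 * (3 * t + 2)) / (2 * (3 * t + 2)))"
    unfolding L_def using assms(1-3)
    by (intro rat_cong_sum_binomial_lucas [where n = p] lucas_quadratic_factor
        rat_fermat') auto
  also have "3 * (t + 1) * L + (t + 1) - 2 * (- t) - 2 * (3 * t + 2)
      = 3 * (t + 1) * (L - 1)"
    by (simp add: algebra_simps)
  finally show ?thesis
    by (simp only: times_divide_eq_left)
qed

lemma rat_cong_sum_binomial_full:
  assumes "3 < p" "t \<in> D p" "\<not> rat_cong p (3 * t + 2) 0"
  defines "L \<equiv> of_int (rat_Legendre ((1 + t) * (1 - 3 * t)) p)"
  shows "rat_cong p (\<Sum>k = 1..p - 1. of_nat ((3 * k) choose k) * (t\<^sup>2 * (t + 1)) ^ k)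
    (3 * (t + 1)\<^sup>2 / (2 * (3 * t + 2)) * (L - 1))"
proof -
  have "rat_cong p (\<Sum>k = 1..p - 1. of_nat ((3 * k) choose k) * (t\<^sup>2 * (t + 1)) ^ k)
      ((3 * (t + 1) * ((t + 1) * L) + (t + 1) * (1 - t) - 2 * (- t)\<^sup>2 - 2 * (3 * t + 2))
        / (2 * (3 * t + 2)))"
    unfolding L_def using assms(1-3)
    by (intro rat_cong_sum_binomial_lucas [where n = "2 * p"] lucas_quadratic_factor
        rat_fermat_double) auto
  also have "3 * (t + 1) * ((t + 1) * L) + (t + 1) * (1 - t) - 2 * (- t)\<^sup>2 - 2 * (3 * t + 2)
      = 3 * (t + 1)\<^sup>2 * (L - 1)"
    by (simp add: algebra_simps power2_eq_square)
  finally show ?thesis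
    by (simp only: times_divide_eq_left)
qed

end

theorem theorem21:
  fixes p :: nat and t :: rat
  assumes "prime p" and "p > 3" and "t \<in> D p"
  shows "(\<not> rat_cong p t 0 \<longrightarrow>
            rat_cong p (\<Sum>k = 1..p div 3. catalan2 k * (t^2 * (t + 1)) ^ k)
              ((1 + t) / (2 * t)
                - (1 - 3 * t) / (2 * t) * of_int (rat_Legendre ((1 + t) * (1 - 3 * t)) p)) \<and>
            rat_cong p (\<Sum>k = 1..p - 1. catalan2 k * (t^2 * (t + 1)) ^ k)
              ((1 + t) * (1 - 3 * t) / (2 * t)
                * (1 - of_int (rat_Legendre ((1 + t) * (1 - 3 * t)) p)))) \<and>
         (\<not> rat_cong p (3 * t + 2) 0 \<longrightarrow>
            rat_cong p (\<Sum>k = 1..p div 3. of_nat ((3 * k) choose k) * (t^2 * (t + 1)) ^ k)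
              (3 * (t + 1) / (2 * (3 * t + 2))
                * (of_int (rat_Legendre ((1 + t) * (1 - 3 * t)) p) - 1)) \<and>
            rat_cong p (\<Sum>k = 1..p - 1. of_nat ((3 * k) choose k) * (t^2 * (t + 1)) ^ k)
              (3 * (t + 1)^2 / (2 * (3 * t + 2))
                * (of_int (rat_Legendre ((1 + t) * (1 - 3 * t)) p) - 1)))"
proof -
  interpret prime_modulus p
    using assms(1) by unfold_locales
  show ?thesis
    using assms(2,3)
    by (intro conjI impI rat_cong_sum_catalan2_div_3 rat_cong_sum_catalan2_full
        rat_cong_sum_binomial_div_3 rat_cong_sum_binomial_full)
qed

end
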